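(* Let $G\colon\mathbb{R}^2\to\mathbb{R}^2$ be a unipotent map of class $C^1$ with $G(0,0)=(0,0)$. Then $$G(D)\cap D=\emptyset\implies G^p(D)\cap G^q(D)=\emptyset$$ for each topological disc $D$ in $\mathbb{R}^2$ and all integers $p\neq q$.
   Context: A differentiable map $G\colon\mathbb{R}^2\to\mathbb{R}^2$ is called unipotent if its spectrum $\mathrm{Spc}(G)=\{\text{eigenvalues of } DG_z : z\in\mathbb{R}^2\}\subset\mathbb{C}$ is the set $\{1\}$. It is known (Campbell) that every $C^1$ unipotent map of $\mathbb{R}^2$ is a bijection with an explicit global inverse. For $m>0$, $G^m$ (respectively $G^{-m}$) is the $m$-fold composition of $G$ (respectively of $G^{-1}$), and $G^0$ is the identity. A subset $D\subset\mathbb{R}^2$ is a topological disc if it is homeomorphic to $\{z\in\mathbb{R}^2 : \|z\|\leq 1\}$. *)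

theory Defs
  imports "HOL-Analysis.Analysis"
begin

text \<open>Eigenvalues of a real matrix are complex numbers: eigenvectors are sought in the
  complexification, so non-real eigenvalues are not lost.\<close>

definition complex_eigenvalue :: "real^'n^'n \<Rightarrow> complex \<Rightarrow> bool" where
  "complex_eigenvalue A \<mu> \<longleftrightarrow>
     (\<exists>v :: complex^'n. v \<noteq> 0 \<and> map_matrix complex_of_real A *v v = \<mu> *s v)"

definition Spc :: "(real^2 \<Rightarrow> real^2) \<Rightarrow> complex set" where
  "Spc G = {\<mu>. \<exists>z. complex_eigenvalue (jacobian G (at z)) \<mu>}"

definition unipotent_map :: "(real^2 \<Rightarrow> real^2) \<Rightarrow> bool" where
  "unipotent_map G \<longleftrightarrow> (\<forall>z. G differentiable at z) \<and> Spc G = {1}"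

definition C1_map :: "(real^2 \<Rightarrow> real^2) \<Rightarrow> bool" where
  "C1_map G \<longleftrightarrow> (\<forall>z. G differentiable at z) \<and> continuous_on UNIV (\<lambda>z. jacobian G (at z))"

text \<open>\<open>inv G\<close> is the two-sided inverse of \<open>G\<close> only when \<open>G\<close> is bijective, which holds for every
  unipotent map of class \<open>C\<^sup>1\<close> of the plane (a theorem of Campbell).\<close>

definition int_iterate :: "('a \<Rightarrow> 'a) \<Rightarrow> int \<Rightarrow> 'a \<Rightarrow> 'a" where
  "int_iterate G p = (if 0 \<le> p then G ^^ nat p else inv G ^^ nat (- p))"

definition topological_disc :: "(real^2) set \<Rightarrow> bool" where
  "topological_disc D \<longleftrightarrow> D homeomorphic (cball 0 1 :: (real^2) set)"

end

theory Submission
  imports Defs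
begin

text \<open>
  Write \<open>G = id + H\<close>.  Unipotence means that the derivative \<open>N z\<close> of \<open>H\<close> at \<open>z\<close> satisfies
  \<open>(N z)\<^sup>2 = 0\<close>, so \<open>H\<close> is, up to a quarter turn, the gradient of a function with vanishing Hessian
  determinant.  As in the theorem of Hartman and Nirenberg on complete flat surfaces, such an \<open>H\<close>
  depends on a single linear coordinate.  The reason is that near a point where \<open>N\<close> does not
  vanish, \<open>H\<close> has rank one and its level sets are curves; along a level curve the direction
  \<open>ker (N z) = im (N z)\<close> is the velocity of the curve traced out by \<open>H\<close>, which depends on the
  level only, so level curves are straight (\<open>ruling_local\<close>).  Moreover in a frame whose
  first vector points along the line, the reciprocal of the one nonzero entry of \<open>N\<close> is affine along
  the line, so that entry cannot tend to zero at a finite point and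
  the whole line consists of points where \<open>N\<close> does not vanish (\<open>ruling_line\<close>, \<open>kernel_line\<close>).
  Two such lines in different directions would meet in a point where both directions lie in the
  kernel of a nonzero \<open>N\<close>, which is absurd; hence all lines are parallel to one vector \<open>v\<close> (any \<open>v\<close> will do
  if \<open>N\<close> vanishes identically), and with
  \<open>G 0 = 0\<close> one gets \<open>G z = z + \<psi> (wedge v z) v\<close> (\<open>unipotent_map_is_shear\<close>).

  In suitable linear coordinates \<open>G\<close> is thus \<open>(s, t) \<mapsto> (s, t + \<psi> s)\<close> and \<open>G\<^sup>c\<close> makes sense for real
  \<open>c\<close>.  It remains to see that a path-connected compact set \<open>K\<close> that is disjoint from its image is
  disjoint from all further images.  This is a planar version of Hopf's proof of the universal
  chord theorem: the set of the \<open>c > 0\<close> for which \<open>K\<close> and \<open>G\<^sup>c K\<close> are disjoint is closed under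
  addition (\<open>shear_disjoint_add\<close>).  Indeed, if \<open>G\<close> moves the leftmost points of \<open>K\<close> upwards, as may be
  assumed after replacing it by its inverse, then \<open>G\<^sup>a K\<close> joins the two sides of the vertical strip
  over \<open>K\<close>, lies above \<open>K\<close> and below the image of \<open>K\<close> for the parameter \<open>a + b\<close>, and so separates
  these two sets.
\<close>

section \<open>Straight level curves of maps with nilpotent derivative\<close>

text \<open>
  With \<open>H = (u, w)\<close> and \<open>u\<close> strictly monotone in the second coordinate, take \<open>(x, u)\<close> as new
  coordinates, with inverse \<open>(x, s) \<mapsto> (x, Y (x, s))\<close>.  Nilpotency makes \<open>w\<close> a function of \<open>s\<close> alone,
  and the slope of the level curve \<open>u = s\<close> at each of its points is the derivative of that function.
  So \<open>Y\<close> is affine in \<open>x\<close>.  Its derivative in \<open>s\<close>, which is the reciprocal of the derivative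
  of \<open>u\<close> in the second coordinate, is then affine in \<open>x\<close> as well.
\<close>
lemma ruling_local:
  fixes H :: "real \<times> real \<Rightarrow> real \<times> real"
    and N :: "real \<times> real \<Rightarrow> (real \<times> real) \<Rightarrow>\<^sub>L (real \<times> real)"
  assumes der: "\<And>z. (H has_derivative blinfun_apply (N z)) (at z)"
    and cont: "continuous_on UNIV N"
    and nil: "\<And>z h. N z (N z h) = 0"
    and ker: "N (x0, y0) (1, 0) = 0"
    and rank: "fst (N (x0, y0) (0, 1)) \<noteq> 0"
  obtains \<delta> A B where "\<delta> > 0"
    "\<And>x. \<bar>x - x0\<bar> < \<delta> \<Longrightarrow> N (x, y0) (1, 0) = 0 \<and> fst (N (x, y0) (0, 1)) \<noteq> 0
        \<and> inverse (fst (N (x, y0) (0, 1))) = A + B * x"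
proof -
  define \<Psi> where "\<Psi> = (\<lambda>z. (fst z, fst (H z)))"
  define \<Psi>' where "\<Psi>' = (\<lambda>z. Blinfun (\<lambda>h::real\<times>real. (fst h, 0::real))
      + (Blinfun (\<lambda>h::real\<times>real. (0::real, fst h)) o\<^sub>L N z))"
  define \<beta> where "\<beta> = fst (N (x0, y0) (0, 1))"
  define J where "J = Blinfun (\<lambda>h::real\<times>real. (fst h, snd h / \<beta>))"
  have bl: "bounded_linear (\<lambda>h::real\<times>real. (fst h, 0::real))"
    "bounded_linear (\<lambda>h::real\<times>real. (0::real, fst h))"
    "bounded_linear (\<lambda>h::real\<times>real. (fst h, snd h / \<beta>))"
    by (intro bounded_linear_Pair bounded_linear_fst bounded_linear_snd bounded_linear_zero
        bounded_linear_compose[OF bounded_linear_divide])+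
  have \<Psi>'_apply: "\<Psi>' z h = (fst h, fst (N z h))" for z h
    by (simp add: \<Psi>'_def blinfun.add_left bounded_linear_Blinfun_apply bl)
  have J_apply: "J h = (fst h, snd h / \<beta>)" for h
    by (simp add: J_def bounded_linear_Blinfun_apply bl)
  have N0: "N (x0, y0) h = snd h *\<^sub>R N (x0, y0) (0, 1)" for h
  proof -
    have "h = fst h *\<^sub>R (1, 0) + snd h *\<^sub>R (0, 1)" by (cases h) simp
    then have "N (x0, y0) h = fst h *\<^sub>R N (x0, y0) (1, 0) + snd h *\<^sub>R N (x0, y0) (0, 1)"
      by (metis blinfun.add_right blinfun.scaleR_right)
    then show ?thesis using ker by simp
  qed
  have der\<Psi>: "(\<Psi> has_derivative blinfun_apply (\<Psi>' z)) (at z)" for z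
  proof -
    have "blinfun_apply (\<Psi>' z) = (\<lambda>h. (fst h, fst (N z h)))" by (rule ext) (rule \<Psi>'_apply)
    then show ?thesis unfolding \<Psi>_def
      by (auto intro!: derivative_eq_intros der)
  qed
  have cont\<Psi>: "continuous_on UNIV \<Psi>'" unfolding \<Psi>'_def
    by (intro continuous_intros cont)
  have inv: "J o\<^sub>L \<Psi>' (x0, y0) = id_blinfun"
  proof (intro blinfun_eqI)
    fix h
    have "fst (N (x0, y0) h) = snd h * \<beta>" by (subst N0) (simp add: \<beta>_def)
    then show "blinfun_apply (J o\<^sub>L \<Psi>' (x0, y0)) h = blinfun_apply id_blinfun h"
      using rank by (simp add: J_apply \<Psi>'_apply \<beta>_def)
  qed
  obtain U V g g' where V: "open V" "\<Psi> (x0, y0) \<in> V" and U: "(x0, y0) \<in> U"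
    and hom: "homeomorphism U V \<Psi> g"
    and derg: "\<And>v. v \<in> V \<Longrightarrow> (g has_derivative g' v) (at v)"
    and g': "\<And>v. v \<in> V \<Longrightarrow> g' v = inv (blinfun_apply (\<Psi>' (g v)))"
    and bij: "\<And>v. v \<in> V \<Longrightarrow> bij (blinfun_apply (\<Psi>' (g v)))"
    using inverse_function_theorem[OF open_UNIV der\<Psi> cont\<Psi> UNIV_I inv] by metis
  have \<Psi>g: "\<Psi> (g v) = v" if "v \<in> V" for v
    using hom that by (simp add: homeomorphism_def)
  have \<Psi>g': "\<Psi>' (g v) (g' v h) = h" if "v \<in> V" for v h
    using bij[OF that] g'[OF that] by (simp add: bij_inv_eq_iff surj_f_inv_f bij_is_surj)
  define s0 where "s0 = fst (H (x0, y0))"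
  have v0: "\<Psi> (x0, y0) = (x0, s0)" by (simp add: \<Psi>_def s0_def)
  have g0: "g (x0, s0) = (x0, y0)"
    using hom U v0 by (metis homeomorphism_apply1)
  define X where "X v = snd (g' v (1, 0))" for v
  define S where "S v = snd (g' v (0, 1))" for v
  define b where "b v = fst (N (g v) (0, 1))" for v
  have fstg: "fst (g v) = fst v" and Hg: "fst (H (g v)) = snd v" if "v \<in> V" for v
    using \<Psi>g[OF that] by (auto simp: \<Psi>_def prod_eq_iff)
  \<comment> \<open>All pointwise linear algebra: the same number \<open>X v\<close> is the slope of the level curve of \<open>u\<close>
      (by the kernel) and the derivative of \<open>w\<close> with respect to \<open>s\<close> (by the image).\<close>
  have pt: "N (g v) (1, X v) = 0 \<and> S v * b v = 1
      \<and> (\<forall>h. g' v h = (fst h, X v * fst h + S v * snd h))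
      \<and> (\<forall>h. N (g v) (g' v h) = (snd h, X v * snd h))" if v: "v \<in> V" for v
  proof -
    define d where "d = snd (N (g v) (0, 1))"
    have N01: "N (g v) (0, 1) = (b v, d)" by (simp add: b_def d_def)
    have N0c: "N (g v) (0, c) = (c * b v, c * d)" for c
      using blinfun.scaleR_right[of "N (g v)" c "(0,1)"] by (simp add: N01)
    have lin: "linear (g' v)" using derg[OF v] has_derivative_linear by blast
    have e: "fst (g' v h) = fst h" "fst (N (g v) (g' v h)) = snd h" for h
      using \<Psi>g'[OF v, of h] by (auto simp: \<Psi>'_apply prod_eq_iff)
    have g1: "g' v (1, 0) = (1, X v)" and g2: "g' v (0, 1) = (0, S v)"
      by (simp_all add: e X_def S_def prod_eq_iff)
    have Sb: "S v * b v = 1" using e(2)[of "(0,1)"] by (simp add: g2 N0c)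
    have b: "b v \<noteq> 0" using Sb by auto
    define c where "c = snd (N (g v) (1, X v))"
    have N1: "N (g v) (1, X v) = (0, c)" using e(2)[of "(1,0)"] by (simp add: c_def g1 prod_eq_iff)
    have "c = 0" using nil[of "g v" "(1, X v)"] b by (simp add: N1 N0c zero_prod_def)
    then have N1: "N (g v) (1, X v) = 0" by (simp add: N1 zero_prod_def)
    have "(b v, d) = b v *\<^sub>R (1, X v) + (0, d - b v * X v)" by simp
    then have "N (g v) (b v, d) = b v *\<^sub>R N (g v) (1, X v) + N (g v) (0, d - b v * X v)"
      by (metis blinfun.add_right blinfun.scaleR_right)
    moreover have "N (g v) (b v, d) = 0" using nil[of "g v" "(0,1)"] by (simp add: N01)
    ultimately have "(d - b v * X v) * b v = 0" by (simp add: N1 N0c zero_prod_def)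
    then have d: "d = b v * X v" using b by simp
    have g'h: "g' v h = fst h *\<^sub>R (1, X v) + snd h *\<^sub>R (0, S v)" for h
    proof -
      have "g' v h = g' v (fst h *\<^sub>R (1, 0) + snd h *\<^sub>R (0, 1))" by simp
      also have "\<dots> = fst h *\<^sub>R g' v (1, 0) + snd h *\<^sub>R g' v (0, 1)"
        by (simp only: linear_add[OF lin] linear_scale[OF lin])
      finally show ?thesis by (simp only: g1 g2)
    qed
    have "N (g v) (g' v h) = (snd h, X v * snd h)" for h
    proof -
      have "N (g v) (g' v h) = fst h *\<^sub>R N (g v) (1, X v) + snd h *\<^sub>R N (g v) (0, S v)"
        unfolding g'h by (metis blinfun.add_right blinfun.scaleR_right)
      also have "\<dots> = (snd h * (S v * b v), snd h * (S v * b v) * X v)" by (simp add: N1 N0c d)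
      finally show ?thesis by (simp add: Sb)
    qed
    then show ?thesis using N1 Sb by (simp add: g'h mult.commute)
  qed
  define Y where "Y v = snd (g v)" for v
  define K where "K v = snd (H (g v))" for v
  have derY: "(Y has_derivative (\<lambda>h. X v * fst h + S v * snd h)) (at v)" if v: "v \<in> V" for v
    unfolding Y_def using has_derivative_snd[OF derg[OF v]] pt[OF v] by simp
  have derK: "(K has_derivative (\<lambda>h. X v * snd h)) (at v)" if v: "v \<in> V" for v
  proof -
    have "((\<lambda>v. H (g v)) has_derivative (\<lambda>h. N (g v) (g' v h))) (at v)"
      by (rule has_derivative_compose[OF derg[OF v] der])
    moreover have "(\<lambda>h. N (g v) (g' v h)) = (\<lambda>h. (snd h, X v * snd h))"
      using pt[OF v] by blast
    ultimately have "((\<lambda>v. H (g v)) has_derivative (\<lambda>h. (snd h, X v * snd h))) (at v)" by simp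
    from has_derivative_snd[OF this] show ?thesis by (simp add: K_def [abs_def])
  qed
  have px: "((\<lambda>x. (x, s)) has_derivative (\<lambda>h. (h, 0))) (at x)" for x s :: real
    by (auto intro!: derivative_eq_intros)
  have ps: "((\<lambda>s. (x, s)) has_derivative (\<lambda>h. (0, h))) (at s)" for x s :: real
    by (auto intro!: derivative_eq_intros)
  have Yx: "((\<lambda>x. Y (x, s)) has_field_derivative X (x, s)) (at x)" if "(x, s) \<in> V" for x s
    using has_derivative_compose[OF px derY[OF that]] by (simp add: has_field_derivative_def)
  have Ys: "((\<lambda>s. Y (x, s)) has_field_derivative S (x, s)) (at s)" if "(x, s) \<in> V" for x s
    using has_derivative_compose[OF ps derY[OF that]] by (simp add: has_field_derivative_def)
  have Kx: "((\<lambda>x. K (x, s)) has_field_derivative 0) (at x)" if "(x, s) \<in> V" for x s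
    using has_derivative_compose[OF px derK[OF that]]
    by (simp add: has_field_derivative_def flip: lambda_zero)
  have Ks: "((\<lambda>s. K (x, s)) has_field_derivative X (x, s)) (at s)" if "(x, s) \<in> V" for x s
    using has_derivative_compose[OF ps derK[OF that]] by (simp add: has_field_derivative_def)
  obtain A B where AB: "open A" "open B" "x0 \<in> A" "s0 \<in> B" "A \<times> B \<subseteq> V"
    using V v0 by (metis open_prod_elim mem_Sigma_iff)
  obtain \<delta> where \<delta>: "\<delta> > 0" "ball x0 \<delta> \<subseteq> A" using AB openE by blast
  obtain \<epsilon> where \<epsilon>: "\<epsilon> > 0" "ball s0 \<epsilon> \<subseteq> B" using AB openE by blast
  have box: "(x, s) \<in> V" if "x \<in> ball x0 \<delta>" "s \<in> ball s0 \<epsilon>" for x s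
    using AB \<delta> \<epsilon> that by blast
  have const: "f x = f x0" if "\<And>x. x \<in> ball x0 \<delta> \<Longrightarrow> (f has_field_derivative 0) (at x)"
    "x \<in> ball x0 \<delta>" for f :: "real \<Rightarrow> real" and x
    by (rule has_field_derivative_zero_constant[of "ball x0 \<delta>" f, THEN exE])
      (use that \<delta> in \<open>auto intro: has_field_derivative_at_within\<close>)
  have Kc: "K (x, s) = K (x0, s)" if "x \<in> ball x0 \<delta>" "s \<in> ball s0 \<epsilon>" for x s
    by (rule const[of "\<lambda>x. K (x, s)"]) (use that box Kx in auto)
  \<comment> \<open>\<open>X\<close> is the derivative in \<open>s\<close> of \<open>K\<close>, which does not depend on \<open>x\<close>.\<close>
  have Xc: "X (x, s) = X (x0, s)" if "x \<in> ball x0 \<delta>" "s \<in> ball s0 \<epsilon>" for x s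
  proof -
    have "((\<lambda>s. K (x0, s)) has_field_derivative X (x, s)) (at s)"
      by (rule has_field_derivative_transform_within_open[OF Ks open_ball])
        (use that box Kc in auto)
    moreover have "((\<lambda>s. K (x0, s)) has_field_derivative X (x0, s)) (at s)"
      using Ks box \<delta> that by auto
    ultimately show ?thesis by (rule DERIV_unique)
  qed
  have Yc: "Y (x, s) = Y (x0, s) + (x - x0) * X (x0, s)"
    if "x \<in> ball x0 \<delta>" "s \<in> ball s0 \<epsilon>" for x s
  proof -
    have "Y (x, s) - x * X (x0, s) = Y (x0, s) - x0 * X (x0, s)"
    proof (rule const[of "\<lambda>x. Y (x, s) - x * X (x0, s)"])
      fix x assume x: "x \<in> ball x0 \<delta>"
      show "((\<lambda>x. Y (x, s) - x * X (x0, s)) has_field_derivative 0) (at x)"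
        using Yx[OF box[OF x that(2)]] Xc[OF x that(2)]
        by (auto intro!: derivative_eq_intros)
    qed fact
    then show ?thesis by (simp add: algebra_simps)
  qed
  have s0: "s0 \<in> ball s0 \<epsilon>" and x0: "x0 \<in> ball x0 \<delta>" using \<epsilon> \<delta> by auto
  \<comment> \<open>The level curve through \<open>(x0, y0)\<close> starts in the direction of the kernel, so it is horizontal.\<close>
  have X0: "X (x0, s0) = 0"
  proof -
    have "N (x0, y0) (1, X (x0, s0)) = 0" using pt[OF box[OF x0 s0]] g0 by simp
    then have "X (x0, s0) *\<^sub>R N (x0, y0) (0, 1) = 0" by (subst (asm) N0) simp
    then show ?thesis using rank by auto
  qed
  \<comment> \<open>Interpolating \<open>Y\<close> between \<open>x0\<close> and a second abscissa lets one differentiate the affine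
      relation in \<open>s\<close> without knowing that its slope \<open>X\<close> is differentiable.\<close>
  define x1 where "x1 = x0 + \<delta> / 2"
  have x1: "x1 \<in> ball x0 \<delta>" using \<delta> by (simp add: x1_def dist_real_def)
  define \<tau> where "\<tau> x = (x - x0) / (\<delta> / 2)" for x
  have Saff: "S (x, s0) = S (x0, s0) + \<tau> x * (S (x1, s0) - S (x0, s0))"
    if x: "x \<in> ball x0 \<delta>" for x
  proof -
    have "((\<lambda>s. Y (x0, s) + \<tau> x * (Y (x1, s) - Y (x0, s))) has_field_derivative
        S (x0, s0) + \<tau> x * (S (x1, s0) - S (x0, s0))) (at s0)"
      using Ys[OF box[OF x0 s0]] Ys[OF box[OF x1 s0]] by (auto intro!: derivative_eq_intros)
    moreover have "Y (x0, s) + \<tau> x * (Y (x1, s) - Y (x0, s)) = Y (x, s)" if "s \<in> ball s0 \<epsilon>" for s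
      using Yc[OF x that] Yc[OF x1 that] \<delta> by (simp add: \<tau>_def x1_def)
    ultimately have "((\<lambda>s. Y (x, s)) has_field_derivative
        S (x0, s0) + \<tau> x * (S (x1, s0) - S (x0, s0))) (at s0)"
      by (rule has_field_derivative_transform_within_open[OF _ open_ball s0])
    then show ?thesis using Ys[OF box[OF x s0]] DERIV_unique by blast
  qed
  show ?thesis
  proof (rule that[OF \<delta>(1)])
    fix x assume "\<bar>x - x0\<bar> < \<delta>"
    then have x: "x \<in> ball x0 \<delta>" by (simp add: dist_real_def abs_minus_commute)
    have "Y (x, s0) = y0" using Yc[OF x s0] X0 g0 by (simp add: Y_def)
    then have gx: "g (x, s0) = (x, y0)" using fstg[OF box[OF x s0]] by (simp add: Y_def prod_eq_iff)
    have p: "N (x, y0) (1, 0) = 0" "S (x, s0) * fst (N (x, y0) (0, 1)) = 1"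
      using pt[OF box[OF x s0]] gx Xc[OF x s0] X0 by (simp_all add: b_def)
    have "inverse (fst (N (x, y0) (0, 1))) = S (x, s0)"
      using p(2) by (metis inverse_unique mult.commute)
    also have "\<dots> = (S (x0, s0) - x0 / (\<delta> / 2) * (S (x1, s0) - S (x0, s0)))
        + (S (x1, s0) - S (x0, s0)) / (\<delta> / 2) * x"
      unfolding Saff[OF x] \<tau>_def
      by (simp add: algebra_simps diff_divide_distrib add_divide_distrib)
    finally show "N (x, y0) (1, 0) = 0 \<and> fst (N (x, y0) (0, 1)) \<noteq> 0
        \<and> inverse (fst (N (x, y0) (0, 1))) =
          (S (x0, s0) - x0 / (\<delta> / 2) * (S (x1, s0) - S (x0, s0)))
        + (S (x1, s0) - S (x0, s0)) / (\<delta> / 2) * x"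
      using p by auto
  qed
qed

text \<open>The pair of intercept and slope of \<open>g\<close> at a point is locally constant.\<close>
lemma locally_affine_imp_affine:
  fixes g :: "real \<Rightarrow> real"
  assumes "connected T"
    and loc: "\<And>x. x \<in> T \<Longrightarrow> \<exists>\<delta>>0. \<exists>A B. \<forall>y. \<bar>y - x\<bar> < \<delta> \<longrightarrow> g y = A + B * y"
  obtains A B where "\<And>x. x \<in> T \<Longrightarrow> g x = A + B * x"
proof (cases "T = {}")
  case False
  then obtain a where a: "a \<in> T" by blast
  define f where "f x = (g x - deriv g x * x, deriv g x)" for x
  have "eventually (\<lambda>y. f x = f y) (at x within T)" if x: "x \<in> T" for x
  proof -
    obtain \<delta> A B where \<delta>: "\<delta> > 0" and g: "\<And>y. \<bar>y - x\<bar> < \<delta> \<Longrightarrow> g y = A + B * y"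
      using loc[OF x] by blast
    have "f y = (A, B)" if y: "y \<in> ball x \<delta>" for y
    proof -
      have "((\<lambda>y. A + B * y) has_field_derivative B) (at y)"
        by (auto intro!: derivative_eq_intros)
      then have "(g has_field_derivative B) (at y)"
        by (rule has_field_derivative_transform_within_open[OF _ open_ball y])
          (simp add: g dist_real_def abs_minus_commute)
      then show ?thesis using g[of y] y
        by (simp add: f_def DERIV_imp_deriv dist_real_def abs_minus_commute)
    qed
    moreover have "x \<in> ball x \<delta>" using \<delta> by simp
    ultimately have "\<forall>y\<in>ball x \<delta>. f x = f y" by simp
    then show ?thesis unfolding eventually_at_topological
      using \<open>x \<in> ball x \<delta>\<close> open_ball by blast
  qed
  then have "f x = f a" if "x \<in> T" for x
    using connected_local_const[OF \<open>connected T\<close> that a, of f] by blast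
  then have "g x = fst (f a) + snd (f a) * x" if "x \<in> T" for x
    using that by (metis add.commute diff_add_cancel f_def fst_conv snd_conv)
  then show ?thesis by (rule that)
qed (use that in auto)

text \<open>
  On the component \<open>T\<close> of the set of good abscissae the reciprocal of the entry \<open>b\<close> is affine, so
  \<open>b x * (A + B * x) = 1\<close> there.  By continuity this identity persists on the closure of \<open>T\<close>,
  where \<open>b\<close> is therefore still nonzero.  So \<open>T\<close> is both open and closed.
\<close>
lemma ruling_line:
  fixes H :: "real \<times> real \<Rightarrow> real \<times> real"
    and N :: "real \<times> real \<Rightarrow> (real \<times> real) \<Rightarrow>\<^sub>L (real \<times> real)"
  assumes der: "\<And>z. (H has_derivative blinfun_apply (N z)) (at z)"
    and cont: "continuous_on UNIV N"
    and nil: "\<And>z h. N z (N z h) = 0"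
    and ker: "N (0, 0) (1, 0) = 0"
    and rank: "fst (N (0, 0) (0, 1)) \<noteq> 0"
  shows "N (x, 0) (1, 0) = 0 \<and> fst (N (x, 0) (0, 1)) \<noteq> 0"
proof -
  define b where "b x = fst (N (x, 0) (0, 1))" for x
  define k where "k x = N (x, 0) (1, 0)" for x
  define S where "S = {x. k x = 0 \<and> b x \<noteq> 0}"
  have loc: "\<exists>\<delta>>0. (\<forall>y. \<bar>y - x\<bar> < \<delta> \<longrightarrow> y \<in> S) \<and>
      (\<exists>A B. \<forall>y. \<bar>y - x\<bar> < \<delta> \<longrightarrow> inverse (b y) = A + B * y)" if "x \<in> S" for x
  proof -
    have x: "N (x, 0) (1, 0) = 0" "fst (N (x, 0) (0, 1)) \<noteq> 0"
      using that by (simp_all add: S_def k_def b_def)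
    obtain \<delta> A B where "\<delta> > 0" "\<And>y. \<bar>y - x\<bar> < \<delta> \<Longrightarrow> N (y, 0) (1, 0) = 0
        \<and> fst (N (y, 0) (0, 1)) \<noteq> 0 \<and> inverse (fst (N (y, 0) (0, 1))) = A + B * y"
      using ruling_local[OF der cont nil x] by metis
    then show ?thesis unfolding S_def k_def b_def by blast
  qed
  have "open S" unfolding open_dist dist_real_def using loc by blast
  define T where "T = connected_component_set S 0"
  have T: "open T" "connected T" "T \<subseteq> S" "0 \<in> T"
    using \<open>open S\<close> ker rank
    by (auto simp: T_def open_connected_component connected_component_subset S_def k_def b_def
        intro!: connected_component_refl)
  obtain A B where AB: "\<And>x. x \<in> T \<Longrightarrow> inverse (b x) = A + B * x"
    using locally_affine_imp_affine[OF T(2), of "\<lambda>x. inverse (b x)"] loc T(3) by (metis subsetD)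
  have contN: "continuous_on UNIV (\<lambda>x. N (x, 0) h)" for h
    by (intro continuous_intros continuous_on_compose2[OF cont]) auto
  have contb: "continuous_on UNIV b" unfolding b_def by (intro continuous_intros contN)
  have "closure T \<subseteq> {x. b x * (A + B * x) = 1}"
  proof (rule closure_minimal)
    show "T \<subseteq> {x. b x * (A + B * x) = 1}"
      using AB T(3) by (auto simp: S_def simp flip: AB)
    show "closed {x. b x * (A + B * x) = 1}"
      by (intro closed_Collect_eq continuous_intros contb)
  qed
  moreover have "closure T \<subseteq> {x. k x = 0}"
  proof (rule closure_minimal)
    show "T \<subseteq> {x. k x = 0}" using T(3) by (auto simp: S_def)
    show "closed {x. k x = 0}" unfolding k_def
      by (intro closed_Collect_eq contN continuous_intros)
  qed
  ultimately have "closure T \<subseteq> S" by (auto simp: S_def)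
  then have "closure T \<subseteq> T" unfolding T_def
    using T(2,4) closure_subset[of T]
    by (intro connected_component_maximal)
      (auto simp: T_def[symmetric] intro: connected_imp_connected_closure)
  then have "closed T" using closure_subset_eq by blast
  then have "T = UNIV" using T(1,4) clopen[of T] by blast
  then show ?thesis using T(3) by (auto simp: S_def k_def b_def)
qed

section \<open>Maps of the plane with nilpotent derivative\<close>

text \<open>The oriented area spanned by two vectors; \<open>wedge v\<close> is, for \<open>v \<noteq> 0\<close>, a linear form with
  kernel spanned by \<open>v\<close>.\<close>
definition wedge :: "real^2 \<Rightarrow> real^2 \<Rightarrow> real" where
  "wedge a b = a$1 * b$2 - a$2 * b$1"

lemma bounded_linear_wedge: "bounded_linear (wedge a)"
  by (rule linear_conv_bounded_linear[THEN iffD1], rule linearI)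
    (simp_all add: wedge_def algebra_simps)

lemma wedge_self [simp]: "wedge a a = 0"
  by (simp add: wedge_def)

lemma wedge_swap: "wedge a b = - wedge b a"
  by (simp add: wedge_def)

text \<open>Cramer's rule.\<close>
lemma wedge_expansion:
  assumes "wedge a b \<noteq> 0"
  shows "h = (wedge h b / wedge a b) *\<^sub>R a + (wedge a h / wedge a b) *\<^sub>R b"
proof -
  have "wedge a b *\<^sub>R h = wedge h b *\<^sub>R a + wedge a h *\<^sub>R b"
    by (simp add: vec_eq_iff forall_2 wedge_def algebra_simps)
  then have "(1 / wedge a b) *\<^sub>R (wedge a b *\<^sub>R h)
      = (1 / wedge a b) *\<^sub>R (wedge h b *\<^sub>R a + wedge a h *\<^sub>R b)" by simp
  then show ?thesis using assms by (simp add: scaleR_add_right)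
qed

lemma wedge_eq_0:
  assumes "wedge v h = 0" "v \<noteq> 0"
  obtains t where "h = t *\<^sub>R v"
proof
  have *: "v \<bullet> v = v$1 * v$1 + v$2 * v$2" "v \<bullet> h = v$1 * h$1 + v$2 * h$2"
    by (simp_all add: inner_vec_def sum_2)
  have "(v \<bullet> v) *\<^sub>R h = (v \<bullet> h) *\<^sub>R v"
    using assms(1) unfolding * wedge_def by (simp add: vec_eq_iff forall_2) algebra
  then have "(1 / (v \<bullet> v)) *\<^sub>R ((v \<bullet> v) *\<^sub>R h) = (1 / (v \<bullet> v)) *\<^sub>R ((v \<bullet> h) *\<^sub>R v)" by simp
  then show "h = ((v \<bullet> h) / (v \<bullet> v)) *\<^sub>R v" using assms(2) by simp
qed

lemma blinfun_zero_on_basis: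
  assumes "wedge a b \<noteq> 0" "blinfun_apply f a = 0" "blinfun_apply f b = 0"
  shows "blinfun_apply f h = 0"
  by (subst wedge_expansion[OF assms(1), of h]) (simp add: blinfun.add_right blinfun.scaleR_right assms)

text \<open>
  Since \<open>v = N p e\<close> lies in the kernel of \<open>N p\<close>, in the frame \<open>(v, e)\<close> based at \<open>p\<close> the matrix of
  \<open>N p\<close> has the single nonzero entry required by \<open>ruling_line\<close>.
\<close>
lemma kernel_line:
  fixes H :: "real^2 \<Rightarrow> real^2" and N :: "real^2 \<Rightarrow> (real^2) \<Rightarrow>\<^sub>L (real^2)"
  assumes der: "\<And>z. (H has_derivative blinfun_apply (N z)) (at z)"
    and cont: "continuous_on UNIV N"
    and nil: "\<And>z h. N z (N z h) = 0"
    and v: "v = N p e" "v \<noteq> 0"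
  shows "N (p + r *\<^sub>R v) v = 0 \<and> N (p + r *\<^sub>R v) e \<noteq> 0"
proof -
  have k: "wedge v e \<noteq> 0"
  proof
    assume "wedge v e = 0"
    then obtain t where "e = t *\<^sub>R v" using wedge_eq_0 v(2) by blast
    then have "N p e = t *\<^sub>R N p v" by (simp add: blinfun.scaleR_right)
    then show False using v nil by simp
  qed
  define L where "L = Blinfun (\<lambda>z::real\<times>real. fst z *\<^sub>R v + snd z *\<^sub>R e)"
  define M where "M = Blinfun (\<lambda>h. (- wedge e h / wedge v e, wedge v h / wedge v e))"
  have L: "L z = fst z *\<^sub>R v + snd z *\<^sub>R e" for z unfolding L_def
    by (subst bounded_linear_Blinfun_apply)
      (auto intro!: bounded_linear_add bounded_linear_scaleR_left[THEN bounded_linear_compose]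
        bounded_linear_fst bounded_linear_snd)
  have M: "M h = (- wedge e h / wedge v e, wedge v h / wedge v e)" for h unfolding M_def
    by (subst bounded_linear_Blinfun_apply)
      (auto intro!: bounded_linear_Pair bounded_linear_minus bounded_linear_wedge
        bounded_linear_compose[OF bounded_linear_divide])
  have LM: "L (M h) = h" for h
    using wedge_expansion[OF k, of h] by (simp add: L M wedge_swap[of h e])
  have Mv: "M v = (1, 0)" using k by (simp add: M wedge_swap[of e v])
  define H' where "H' z = M (H (p + L z))" for z
  define N' where "N' z = M o\<^sub>L (N (p + L z) o\<^sub>L L)" for z
  have N': "N' z h = M (N (p + L z) (L h))" for z h by (simp add: N'_def)
  have "((\<lambda>z. p + L z) has_derivative blinfun_apply L) (at z)" for z
    by (auto intro!: derivative_eq_intros bounded_linear_imp_has_derivative blinfun.bounded_linear_right)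
  then have "((\<lambda>z. H (p + L z)) has_derivative (\<lambda>h. N (p + L z) (L h))) (at z)" for z
    using has_derivative_compose der by blast
  then have der': "(H' has_derivative blinfun_apply (N' z)) (at z)" for z
    unfolding H'_def N' [abs_def]
    using bounded_linear.has_derivative[OF blinfun.bounded_linear_right] by blast
  have cont': "continuous_on UNIV N'" unfolding N'_def
    by (intro continuous_intros continuous_on_compose2[OF cont]) auto
  have nil': "N' z (N' z h) = 0" for z h by (simp add: N' LM nil)
  have *: "N' (0, 0) (1, 0) = 0" "fst (N' (0, 0) (0, 1)) \<noteq> 0"
    using nil[of p e] by (simp_all add: N' L Mv flip: v(1))
  from ruling_line[OF der' cont' nil' *, of r]
  have r: "M (N (p + r *\<^sub>R v) v) = 0" "fst (M (N (p + r *\<^sub>R v) e)) \<noteq> 0" by (simp_all add: N' L)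
  have "N (p + r *\<^sub>R v) v = 0" using LM[of "N (p + r *\<^sub>R v) v"] r(1) by simp
  moreover have "N (p + r *\<^sub>R v) e \<noteq> 0" using r(2) by auto
  ultimately show ?thesis by blast
qed

text \<open>
  If \<open>v\<close> spans the image of \<open>N p\<close> and some \<open>N z\<close> does not kill \<open>v\<close>, then the line through \<open>z\<close> in the
  direction of the image of \<open>N z\<close> crosses the line through \<open>p\<close> in the direction \<open>v\<close>.  At the crossing
  point two independent vectors are killed, although the derivative does not vanish there.
\<close>
lemma common_kernel:
  fixes H :: "real^2 \<Rightarrow> real^2" and N :: "real^2 \<Rightarrow> (real^2) \<Rightarrow>\<^sub>L (real^2)"
  assumes der: "\<And>z. (H has_derivative blinfun_apply (N z)) (at z)"
    and cont: "continuous_on UNIV N"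
    and nil: "\<And>z h. N z (N z h) = 0"
  obtains v where "v \<noteq> 0" "\<And>z. N z v = 0" "\<And>z h. wedge v (N z h) = 0"
proof (cases "\<forall>p e. N p e = 0")
  case True
  show ?thesis by (rule that[of "axis 1 1"]) (simp_all add: True wedge_def axis_eq_0_iff)
next
  case False
  then obtain p e where "N p e \<noteq> 0" by blast
  define v where "v = N p e"
  have v: "v \<noteq> 0" using \<open>N p e \<noteq> 0\<close> by (simp add: v_def)
  have Nv: "N z v = 0" for z
  proof (rule ccontr)
    assume nz: "N z v \<noteq> 0"
    define v' where "v' = N z v"
    have v': "v' \<noteq> 0" using nz by (simp add: v'_def)
    have k: "wedge v v' \<noteq> 0"
    proof
      assume "wedge v v' = 0"
      then obtain t where t: "v' = t *\<^sub>R v" using wedge_eq_0 v by blast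
      then have "t *\<^sub>R N z v = 0" using nil[of z v] by (simp add: blinfun.scaleR_right v'_def)
      then show False using nz t v' by auto
    qed
    define r where "r = wedge (z - p) v' / wedge v v'"
    define r' where "r' = - wedge v (z - p) / wedge v v'"
    have "z - p = r *\<^sub>R v - r' *\<^sub>R v'"
      using wedge_expansion[OF k, of "z - p"] by (simp add: r_def r'_def)
    then have c: "p + r *\<^sub>R v = z + r' *\<^sub>R v'" by (simp add: algebra_simps)
    have 1: "N (p + r *\<^sub>R v) v = 0" "N (p + r *\<^sub>R v) e \<noteq> 0"
      using kernel_line[OF der cont nil v_def v] by auto
    have "N (z + r' *\<^sub>R v') v' = 0" using kernel_line[OF der cont nil v'_def v'] by auto
    then have "N (p + r *\<^sub>R v) e = 0" using blinfun_zero_on_basis[OF k 1(1)] c by simp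
    then show False using 1 by simp
  qed
  show ?thesis
  proof (rule that[OF v Nv])
    fix z h
    show "wedge v (N z h) = 0"
    proof (rule ccontr)
      assume k: "wedge v (N z h) \<noteq> 0"
      then have "N z h = 0" by (rule blinfun_zero_on_basis) (simp_all add: Nv nil)
      then show False using k by (simp add: wedge_def)
    qed
  qed
qed

text \<open>
  The vector \<open>v\<close> spans both the common kernel, so that \<open>H\<close> is constant along \<open>v\<close>, and the common
  image, so that \<open>H\<close> stays on the line through \<open>H 0 = 0\<close> spanned by \<open>v\<close>.
\<close>
lemma nilpotent_derivative_imp_ridge:
  fixes H :: "real^2 \<Rightarrow> real^2" and N :: "real^2 \<Rightarrow> (real^2) \<Rightarrow>\<^sub>L (real^2)"
  assumes der: "\<And>z. (H has_derivative blinfun_apply (N z)) (at z)"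
    and cont: "continuous_on UNIV N"
    and nil: "\<And>z h. N z (N z h) = 0"
    and "H 0 = 0"
  obtains v \<psi> where "v \<noteq> 0" "continuous_on UNIV \<psi>" "\<And>z. H z = \<psi> (wedge v z) *\<^sub>R v"
proof -
  obtain v where v: "v \<noteq> 0" and ker: "\<And>z. N z v = 0" and im: "\<And>z h. wedge v (N z h) = 0"
    using common_kernel[OF der cont nil] by blast
  have along: "H (z + r *\<^sub>R v) = H z" for z r
  proof -
    have "((\<lambda>r. z + r *\<^sub>R v) has_derivative (\<lambda>h. h *\<^sub>R v)) (at r)" for r
      by (auto intro!: derivative_eq_intros)
    then have "((\<lambda>r. H (z + r *\<^sub>R v)) has_derivative (\<lambda>h. N (z + r *\<^sub>R v) (h *\<^sub>R v))) (at r)" for r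
      using has_derivative_compose der by blast
    then have "((\<lambda>r. H (z + r *\<^sub>R v)) has_derivative (\<lambda>h. 0)) (at r within UNIV)" for r
      by (simp add: blinfun.scaleR_right ker)
    then obtain c where "\<And>r. H (z + r *\<^sub>R v) = c"
      using has_derivative_zero_constant[OF convex_UNIV] by (metis UNIV_I)
    from this[of r] this[of 0] show ?thesis by simp
  qed
  have "((\<lambda>z. wedge v (H z)) has_derivative (\<lambda>h. 0)) (at z within UNIV)" for z
    using bounded_linear.has_derivative[OF bounded_linear_wedge der, of v z] by (simp add: im)
  then obtain c where "\<And>z. wedge v (H z) = c"
    using has_derivative_zero_constant[OF convex_UNIV] by (metis UNIV_I)
  from this this[of 0] have "wedge v (H z) = 0" for z by (simp add: \<open>H 0 = 0\<close> wedge_def)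
  then have Hv: "H z = ((v \<bullet> H z) / (v \<bullet> v)) *\<^sub>R v" for z
  proof -
    obtain t where "H z = t *\<^sub>R v" using wedge_eq_0[OF \<open>wedge v (H z) = 0\<close> v] .
    then show ?thesis using v by simp
  qed
  \<comment> \<open>The multiples of \<open>e\<close> form a section of \<open>wedge v\<close>.\<close>
  define e where "e = (1 / (v \<bullet> v)) *\<^sub>R (vector [- v$2, v$1] :: real^2)"
  have we: "wedge v (s *\<^sub>R e) = s" for s
  proof -
    have "wedge v (s *\<^sub>R e) = s * (v \<bullet> v) / (v \<bullet> v)"
      by (simp add: wedge_def e_def inner_vec_def sum_2 add_divide_distrib algebra_simps)
    then show ?thesis using v by simp
  qed
  define \<psi> where "\<psi> s = (v \<bullet> H (s *\<^sub>R e)) / (v \<bullet> v)" for s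
  have "continuous_on UNIV H"
    using der has_derivative_continuous continuous_at_imp_continuous_on by blast
  then have "continuous_on UNIV (\<lambda>s. H (s *\<^sub>R e))"
    by (rule continuous_on_compose2) (auto intro!: continuous_intros)
  then have c\<psi>: "continuous_on UNIV \<psi>" unfolding \<psi>_def
    by (intro continuous_intros) (use v in auto)
  have "H z = \<psi> (wedge v z) *\<^sub>R v" for z
  proof -
    have "wedge v (z - wedge v z *\<^sub>R e) = 0"
      using we by (simp add: bounded_linear.linear[OF bounded_linear_wedge] linear_diff)
    then obtain t where "z - wedge v z *\<^sub>R e = t *\<^sub>R v" using wedge_eq_0 v by blast
    then have "z = wedge v z *\<^sub>R e + t *\<^sub>R v" by (simp add: algebra_simps)
    then have "H z = H (wedge v z *\<^sub>R e)" using along by metis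
    then show ?thesis using Hv[of "wedge v z *\<^sub>R e"] by (simp add: \<psi>_def)
  qed
  then show ?thesis using that v c\<psi> by blast
qed

section \<open>Unipotent maps of the plane are shears\<close>

text \<open>
  A vector killed by a nonzero row of \<open>A - \<mu>\<close> is also killed by the other row, which is proportional
  to it; if both rows vanish, every vector is an eigenvector.
\<close>
lemma complex_eigenvalue_if_charpoly:
  fixes A :: "real^2^2"
  assumes "(complex_of_real (A$1$1) - \<mu>) * (complex_of_real (A$2$2) - \<mu>)
    - complex_of_real (A$1$2) * complex_of_real (A$2$1) = 0"
  shows "complex_eigenvalue A \<mu>"
proof -
  define a b c d where abcd: "a = complex_of_real (A$1$1)" "b = complex_of_real (A$1$2)"
    "c = complex_of_real (A$2$1)" "d = complex_of_real (A$2$2)"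
  have char: "(a - \<mu>) * (d - \<mu>) = b * c" using assms by (simp add: abcd)
  have ev: "complex_eigenvalue A \<mu>"
    if "a * x + b * y = \<mu> * x" "c * x + d * y = \<mu> * y" "x \<noteq> 0 \<or> y \<noteq> 0" for x y
    unfolding complex_eigenvalue_def
    by (rule exI[of _ "vector [x, y]"])
      (use that in \<open>auto simp: vec_eq_iff forall_2 matrix_vector_mult_def sum_2 map_matrix_def abcd\<close>)
  consider "b \<noteq> 0 \<or> \<mu> \<noteq> a" | "c \<noteq> 0 \<or> \<mu> \<noteq> d" | "b = 0" "c = 0" "\<mu> = a" "\<mu> = d" by blast
  then show ?thesis
  proof cases
    case 1
    then show ?thesis using char by (intro ev[of b "\<mu> - a"]) (auto simp: algebra_simps)
  next
    case 2
    then show ?thesis using char by (intro ev[of "\<mu> - d" c]) (auto simp: algebra_simps)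
  next
    case 3
    then show ?thesis by (intro ev[of 1 0]) auto
  qed
qed

text \<open>
  Both roots of the characteristic polynomial are eigenvalues, hence equal to 1; so \<open>A - 1\<close> has
  trace and determinant zero, and the Cayley-Hamilton identity applies.
\<close>
lemma unipotent_matrix_nilpotent:
  fixes A :: "real^2^2"
  assumes "\<And>\<mu>. complex_eigenvalue A \<mu> \<Longrightarrow> \<mu> = 1"
  shows "(A - mat 1) *v ((A - mat 1) *v h) = 0"
proof -
  define a b c d where abcd: "a = A$1$1" "b = A$1$2" "c = A$2$1" "d = A$2$2"
  define r where "r = csqrt (complex_of_real ((a + d)^2 - 4 * (a * d - b * c)))"
  have r2: "r^2 = complex_of_real ((a + d)^2 - 4 * (a * d - b * c))" by (simp add: r_def)
  have root: "(complex_of_real (a + d) + s) / 2 = 1" if s: "s^2 = r^2" for s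
  proof (rule assms, rule complex_eigenvalue_if_charpoly)
    have "s * s = (complex_of_real a + complex_of_real d)^2
        - 4 * (complex_of_real a * complex_of_real d - complex_of_real b * complex_of_real c)"
      using s r2 by (simp add: power2_eq_square)
    then show "(complex_of_real (A$1$1) - (complex_of_real (a + d) + s) / 2)
        * (complex_of_real (A$2$2) - (complex_of_real (a + d) + s) / 2)
        - complex_of_real (A$1$2) * complex_of_real (A$2$1) = 0"
      unfolding abcd[symmetric] by (simp add: field_simps power2_eq_square)
  qed
  have "(complex_of_real (a + d) + r) / 2 = 1" "(complex_of_real (a + d) + - r) / 2 = 1"
    by (rule root; simp)+
  then have sum: "complex_of_real (a + d) + r = 2" and diff: "complex_of_real (a + d) - r = 2"
    by (simp_all add: field_simps)
  have "2 * r = (complex_of_real (a + d) + r) - (complex_of_real (a + d) - r)" by simp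
  also have "\<dots> = 0" by (simp only: sum diff diff_self)
  finally have r0: "r = 0" by simp
  then have "complex_of_real (a + d) = complex_of_real 2" using sum by simp
  then have "a + d = 2" by (simp only: of_real_eq_iff)
  then have tr: "d = 2 - a" by simp
  have "complex_of_real ((a + d)^2 - 4 * (a * d - b * c)) = complex_of_real 0" using r2 r0 by simp
  then have "(a + d)^2 - 4 * (a * d - b * c) = 0" by (simp only: of_real_eq_iff)
  then have det: "b * c = - (a - 1) * (a - 1)" by (simp add: tr power2_eq_square algebra_simps)
  have entries: "(A - mat 1)$1$1 = a - 1" "(A - mat 1)$1$2 = b" "(A - mat 1)$2$1 = c"
    "(A - mat 1)$2$2 = 1 - a" by (simp_all add: mat_def tr flip: abcd)
  show ?thesis
    unfolding vec_eq_iff forall_2 matrix_vector_mult_def sum_2 vec_lambda_beta entries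
    using det by simp algebra
qed

lemma unipotent_map_is_shear:
  fixes G :: "real^2 \<Rightarrow> real^2"
  assumes "unipotent_map G" "C1_map G" "G 0 = 0"
  obtains v \<psi> where "v \<noteq> 0" "continuous_on UNIV \<psi>" "\<And>z. G z = z + \<psi> (wedge v z) *\<^sub>R v"
proof -
  define M where "M z = jacobian G (at z) - mat 1" for z
  define N where "N z = Blinfun (\<lambda>h. M z *v h)" for z
  have N: "N z h = M z *v h" for z h
    by (simp add: N_def bounded_linear_Blinfun_apply matrix_vector_mul_bounded_linear)
  have nil: "N z (N z h) = 0" for z h
    unfolding N M_def
    by (rule unipotent_matrix_nilpotent)
      (use assms(1) in \<open>auto simp: unipotent_map_def Spc_def\<close>)
  have der: "((\<lambda>z. G z - z) has_derivative blinfun_apply (N z)) (at z)" for z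
  proof -
    have "(G has_derivative (\<lambda>h. jacobian G (at z) *v h)) (at z)"
      using assms(1) jacobian_works by (auto simp: unipotent_map_def)
    then have "((\<lambda>z. G z - z) has_derivative (\<lambda>h. jacobian G (at z) *v h - h)) (at z)"
      by (intro derivative_intros)
    then show ?thesis by (simp add: N [abs_def] M_def matrix_vector_mult_diff_rdistrib)
  qed
  have cM: "continuous_on UNIV M" unfolding M_def
    using assms(2) by (intro continuous_intros) (simp add: C1_map_def)
  have cont: "continuous_on UNIV N"
    by (rule continuous_on_blinfun_componentwise)
      (auto simp: N matrix_vector_mult_def intro!: continuous_intros cM)
  obtain v \<psi> where "v \<noteq> 0" "continuous_on UNIV \<psi>" "\<And>z. G z - z = \<psi> (wedge v z) *\<^sub>R v"
    using nilpotent_derivative_imp_ridge[OF der cont nil] assms(3) by (metis diff_0_right)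
  then show ?thesis using that by (metis add.commute diff_add_cancel)
qed

section \<open>Chords of path-connected sets under shears\<close>

definition shear :: "(real \<Rightarrow> real) \<Rightarrow> real \<Rightarrow> real^2 \<Rightarrow> real^2" where
  "shear \<psi> c z = z + (c * \<psi> (z$1)) *\<^sub>R axis 2 1"

lemma shear_nth [simp]: "shear \<psi> c z $ 1 = z$1" "shear \<psi> c z $ 2 = z$2 + c * \<psi> (z$1)"
  by (simp_all add: shear_def axis_def)

lemma shear_shear: "shear \<psi> a (shear \<psi> b z) = shear \<psi> (a + b) z"
  by (simp add: vec_eq_iff forall_2 algebra_simps)

lemma inj_shear: "inj (shear \<psi> c)"
  by (auto intro!: injI simp: vec_eq_iff forall_2)

lemma continuous_on_shear: "continuous_on UNIV \<psi> \<Longrightarrow> continuous_on S (shear \<psi> c)"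
  unfolding shear_def
  by (auto intro!: continuous_intros continuous_on_compose2[of UNIV \<psi>])

text \<open>
  Let \<open>K'\<close> and \<open>K''\<close> be the images of \<open>K\<close> under the shears with parameters \<open>a\<close> and \<open>a + b\<close>.  On the
  leftmost line meeting \<open>K\<close> everything moves upwards, so the lowest point of \<open>K\<close> on it lies below
  \<open>K'\<close> and the highest point of \<open>K''\<close> on it lies above \<open>K'\<close>.  If \<open>K\<close> met \<open>K''\<close>, a path inside
  \<open>K \<union> K''\<close>, prolonged vertically along that line, would cross a box from bottom to top, while
  \<open>K'\<close> contains a path crossing it from left to right.  The two paths would have to meet,
  by Fashoda's theorem.
\<close>
lemma shear_disjoint_add:
  fixes K :: "(real^2) set"
  assumes K: "compact K" "path_connected K"
    and \<psi>: "continuous_on UNIV \<psi>"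
    and z0: "z0 \<in> K" "\<And>z. z \<in> K \<Longrightarrow> z0$1 \<le> z$1" "\<psi> (z0$1) > 0"
    and a: "a > 0" and b: "b > 0"
    and disj_a: "shear \<psi> a ` K \<inter> K = {}"
    and disj_b: "shear \<psi> b ` K \<inter> K = {}"
  shows "shear \<psi> (a + b) ` K \<inter> K = {}"
proof (rule ccontr)
  assume "shear \<psi> (a + b) ` K \<inter> K \<noteq> {}"
  then obtain x where x: "x \<in> K" "x \<in> shear \<psi> (a + b) ` K" by blast
  define K' where "K' = shear \<psi> a ` K"
  define K'' where "K'' = shear \<psi> (a + b) ` K"
  have conn: "path_connected K'" "path_connected K''" and comp: "compact K'" "compact K''"
    unfolding K'_def K''_def
    using K continuous_on_shear[OF \<psi>]
    by (auto intro: path_connected_continuous_image compact_continuous_image)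
  have disj: "K \<inter> K' = {}" "K' \<inter> K'' = {}"
  proof -
    show "K \<inter> K' = {}" using disj_a by (auto simp: K'_def)
    have "K'' = shear \<psi> a ` shear \<psi> b ` K" by (simp add: K''_def image_image shear_shear)
    then have "K' \<inter> K'' = shear \<psi> a ` (K \<inter> shear \<psi> b ` K)"
      by (simp add: K'_def image_Int[OF inj_shear])
    then show "K' \<inter> K'' = {}" using disj_b by blast
  qed
  define s0 where "s0 = z0$1"
  have pos: "\<psi> s0 > 0" using z0(3) by (simp add: s0_def)
  \<comment> \<open>\<open>p\<close> and \<open>q\<close> are the lowest and the highest point of \<open>K\<close> on its leftmost line.\<close>
  define L where "L = K \<inter> {z. z$1 = s0}"
  have L: "compact L" "L \<noteq> {}"
    using K(1) z0(1) unfolding L_def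
    by (auto intro!: compact_Int_closed closed_Collect_eq continuous_intros simp: s0_def)
  have c2: "continuous_on L (\<lambda>z. z$2)" and c1: "continuous_on K (\<lambda>z. z$1)"
    by (intro continuous_intros)+
  obtain p where p: "p \<in> L" "\<And>z. z \<in> L \<Longrightarrow> p$2 \<le> z$2"
    using continuous_attains_inf[OF L c2] by blast
  obtain q where q: "q \<in> L" "\<And>z. z \<in> L \<Longrightarrow> z$2 \<le> q$2"
    using continuous_attains_sup[OF L c2] by blast
  obtain w where w: "w \<in> K" "\<And>z. z \<in> K \<Longrightarrow> z$1 \<le> w$1"
    using continuous_attains_sup[OF K(1) _ c1] z0(1) by blast
  have "bounded (K \<union> K' \<union> K'')" using K(1) comp by (simp add: compact_imp_bounded)
  then obtain M where M: "\<And>z. z \<in> K \<union> K' \<union> K'' \<Longrightarrow> norm z \<le> M"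
    unfolding bounded_iff by metis
  define lo where "lo = (vector [s0, - M] :: real^2)"
  define hi where "hi = (vector [w$1, M] :: real^2)"
  have lohi: "lo$1 = s0" "lo$2 = -M" "hi$1 = w$1" "hi$2 = M" by (simp_all add: lo_def hi_def)
  have box: "K \<union> K' \<union> K'' \<subseteq> cbox lo hi"
  proof
    fix z assume z: "z \<in> K \<union> K' \<union> K''"
    then have "s0 \<le> z$1 \<and> z$1 \<le> w$1" using z0(2) w(2) by (auto simp: K'_def K''_def s0_def)
    moreover have "\<bar>z$2\<bar> \<le> M" using M[OF z] component_le_norm_cart[of z 2] by linarith
    ultimately show "z \<in> cbox lo hi" by (auto simp: mem_box_cart forall_2 lohi)
  qed
  define q'' where "q'' = shear \<psi> (a + b) q"
  define top where "top = (vector [s0, M] :: real^2)"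
  have q''K: "q'' \<in> K''" using q(1) by (auto simp: q''_def K''_def L_def)
  have pK: "p \<in> K" using p(1) by (simp add: L_def)
  have q''1: "q''$1 = s0" and p1: "p$1 = s0" using q(1) p(1) by (auto simp: q''_def L_def)
  have ends: "shear \<psi> a z0 \<in> K'" "shear \<psi> a w \<in> K'" and xK'': "x \<in> K''"
    using z0(1) w(1) x(2) by (auto simp: K'_def K''_def)
  obtain f where f: "path f" "path_image f \<subseteq> K'" "pathstart f = shear \<psi> a z0"
    "pathfinish f = shear \<psi> a w"
    using conn(1) ends unfolding path_connected_def by meson
  obtain g1 where g1: "path g1" "path_image g1 \<subseteq> K" "pathstart g1 = p" "pathfinish g1 = x"
    using K(2) pK x(1) unfolding path_connected_def by meson
  obtain g2 where g2: "path g2" "path_image g2 \<subseteq> K''" "pathstart g2 = x" "pathfinish g2 = q''"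
    using conn(2) q''K xK'' unfolding path_connected_def by meson
  define g where "g = linepath lo p +++ g1 +++ g2 +++ linepath q'' top"
  have pg: "path g" unfolding g_def using g1 g2 by simp
  have gi: "path_image g = closed_segment lo p \<union> path_image g1 \<union> path_image g2
      \<union> closed_segment q'' top"
    unfolding g_def using g1 g2 by (simp add: path_image_join Un_assoc)
  have "\<bar>p$2\<bar> \<le> M" "\<bar>q''$2\<bar> \<le> M"
    using M[of p] M[of q''] pK q''K component_le_norm_cart[of p 2] component_le_norm_cart[of q'' 2]
    by auto
  have "0 \<le> M" and "s0 \<le> w$1" using \<open>\<bar>p$2\<bar> \<le> M\<close> z0(2) w(1) by (auto simp: s0_def)
  then have bt: "lo \<in> cbox lo hi" "top \<in> cbox lo hi"
    by (auto simp: mem_box_cart forall_2 lohi lohi top_def)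
  have "p \<in> cbox lo hi" "q'' \<in> cbox lo hi" using box pK q''K by auto
  then have "closed_segment lo p \<subseteq> cbox lo hi" "closed_segment q'' top \<subseteq> cbox lo hi"
    using bt by (simp_all add: closed_segment_subset)
  then have gbox: "path_image g \<subseteq> cbox lo hi"
    unfolding gi using box g1(2) g2(2) by auto
  have fbox: "path_image f \<subseteq> cbox lo hi" using f(2) box by blast
  have "pathstart f $ 1 = lo $ 1" "pathfinish f $ 1 = hi $ 1"
    "pathstart g $ 2 = lo $ 2" "pathfinish g $ 2 = hi $ 2"
    by (simp_all add: f lohi s0_def g_def lohi top_def)
  then obtain z where zf: "z \<in> path_image f" and zg: "z \<in> path_image g"
    using fashoda[OF f(1) pg fbox gbox] by metis
  have "z \<in> K'" using zf f(2) by blast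
  then obtain y where y: "y \<in> K" "z = shear \<psi> a y" by (auto simp: K'_def)
  have segL: "y \<in> L" if "z$1 = s0" using that y by (simp add: L_def)
  have seg: "z$1 = s0 \<and> z$2 \<le> max (u$2) (t$2) \<and> min (u$2) (t$2) \<le> z$2"
    if st: "z \<in> closed_segment u t" "u$1 = s0" "t$1 = s0" for u t
  proof -
    obtain \<theta> where \<theta>: "0 \<le> \<theta>" "\<theta> \<le> 1" "z = (1 - \<theta>) *\<^sub>R u + \<theta> *\<^sub>R t"
      using st(1) unfolding in_segment by blast
    have "z$2 \<in> closed_segment (u$2) (t$2)"
      unfolding closed_segment_def using \<theta> by (intro CollectI exI[of _ \<theta>]) simp
    then have "z$2 \<le> max (u$2) (t$2) \<and> min (u$2) (t$2) \<le> z$2"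
      unfolding closed_segment_eq_real_ivl by (simp split: if_splits)
    moreover have "z$1 = s0" unfolding \<theta>(3) using st(2,3) by (simp add: algebra_simps)
    ultimately show ?thesis by blast
  qed
  consider "z \<in> closed_segment lo p" | "z \<in> K \<union> K''" | "z \<in> closed_segment q'' top"
    using zg gi g1(2) g2(2) by blast
  then show False
  proof cases
    case 1
    then have z: "z$1 = s0" "z$2 \<le> p$2" using seg[OF 1] p1 \<open>\<bar>p$2\<bar> \<le> M\<close> by (auto simp: lohi)
    then have "p$2 \<le> y$2" using p(2) segL by blast
    moreover have "y$1 = s0" using z y by simp
    moreover have "a * \<psi> s0 > 0" using a pos by simp
    ultimately show False using z(2) y(2) by simp
  next
    case 2
    then show False using disj \<open>z \<in> K'\<close> by blast
  next
    case 3
    then have z: "z$1 = s0" "q''$2 \<le> z$2" using seg[OF 3] q''1 \<open>\<bar>q''$2\<bar> \<le> M\<close> by (auto simp: top_def)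
    then have "y$2 \<le> q$2" using q(2) segL by blast
    moreover have "y$1 = s0" "q$1 = s0" using z y q''1 by (simp_all add: q''_def)
    moreover have "b * \<psi> s0 > 0" using b pos by simp
    ultimately show False using z(2) y(2) by (simp add: q''_def algebra_simps)
  qed
qed

text \<open>
  The leftmost point of \<open>K\<close> is not fixed, so \<open>\<psi>\<close> does not vanish there; if it is negative, the
  inverse shear is used, since \<open>K\<close> meets its image iff it meets its preimage.
\<close>
lemma shear_disjoint_iterate:
  fixes K :: "(real^2) set"
  assumes K: "compact K" "path_connected K" "K \<noteq> {}"
    and \<psi>: "continuous_on UNIV \<psi>"
    and disj: "shear \<psi> 1 ` K \<inter> K = {}"
  shows "shear \<psi> (real (Suc n)) ` K \<inter> K = {}"
proof -
  have cont: "continuous_on K (\<lambda>z. z$1)" by (intro continuous_intros)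
  obtain z0 where z0: "z0 \<in> K" "\<And>z. z \<in> K \<Longrightarrow> z0$1 \<le> z$1"
    using continuous_attains_inf[OF K(1,3) cont] by blast
  have main: "shear \<phi> (real (Suc n)) ` K \<inter> K = {}"
    if "continuous_on UNIV \<phi>" "\<phi> (z0$1) > 0" "shear \<phi> 1 ` K \<inter> K = {}" for \<phi> n
  proof (induction n)
    case (Suc n)
    then show ?case
      using shear_disjoint_add[OF K(1,2) that(1) z0 that(2), of 1 "real (Suc n)"] that(3)
      by simp
  qed (use that in simp)
  have neg: "shear (\<lambda>s. - \<psi> s) c ` K \<inter> K = {} \<longleftrightarrow> shear \<psi> c ` K \<inter> K = {}" for c
  proof -
    have "shear (\<lambda>s. - \<psi> s) c z = z' \<longleftrightarrow> shear \<psi> c z' = z" for z z'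
      by (auto simp: vec_eq_iff forall_2)
    then have "(\<exists>z\<in>K. shear (\<lambda>s. - \<psi> s) c z \<in> K) \<longleftrightarrow> (\<exists>z\<in>K. shear \<psi> c z \<in> K)" by metis
    moreover have "F ` K \<inter> K = {} \<longleftrightarrow> \<not> (\<exists>z\<in>K. F z \<in> K)" for F by auto
    ultimately show ?thesis by blast
  qed
  have "\<psi> (z0$1) \<noteq> 0"
  proof
    assume "\<psi> (z0$1) = 0"
    then have "shear \<psi> 1 z0 = z0" by (simp add: vec_eq_iff forall_2)
    then show False using disj z0(1) by (metis IntI empty_iff imageI)
  qed
  then consider "\<psi> (z0$1) > 0" | "- \<psi> (z0$1) > 0" by linarith
  then show ?thesis
  proof cases
    case 1
    then show ?thesis using main \<psi> disj by blast
  next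
    case 2
    then show ?thesis
      using main[of "\<lambda>s. - \<psi> s"] \<psi> disj neg by (auto intro: continuous_on_minus)
  qed
qed

section \<open>Iterates of discs\<close>

text \<open>
  \<open>G\<close> preserves \<open>wedge v\<close>, so on each fibre of \<open>wedge v\<close> it is a translation by a constant vector and
  its inverse is the opposite translation.
\<close>
lemma int_iterate_translation_along_fibres:
  fixes G :: "real^2 \<Rightarrow> real^2"
  assumes G: "\<And>z. G z = z + \<psi> (wedge v z) *\<^sub>R v"
  shows "int_iterate G p z = z + (of_int p * \<psi> (wedge v z)) *\<^sub>R v"
proof -
  have w: "wedge v (z + t *\<^sub>R v) = wedge v z" for z t by (simp add: wedge_def algebra_simps)
  have pow: "(F ^^ n) z = z + (real n * \<phi> (wedge v z)) *\<^sub>R v"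
    if "\<And>z. F z = z + \<phi> (wedge v z) *\<^sub>R v" for F \<phi> n z
    by (induction n) (simp_all add: that w algebra_simps)
  have "inv G z = z + (- \<psi> (wedge v z)) *\<^sub>R v" for z
  proof -
    have "inj G"
    proof (rule injI)
      fix x y assume "G x = G y"
      moreover from this have "wedge v x = wedge v y" by (metis G w)
      ultimately show "x = y" by (simp add: G)
    qed
    moreover have "G (z + (- \<psi> (wedge v z)) *\<^sub>R v) = z" by (simp only: G w) simp
    ultimately show ?thesis by (metis inv_f_f)
  qed
  from pow[OF G] pow[where \<phi>="\<lambda>s. - \<psi> s", OF this] show ?thesis
    by (cases "0 \<le> p") (simp_all add: int_iterate_def)
qed

theorem theorem4p6:
  fixes G :: "real^2 \<Rightarrow> real^2"
  assumes "unipotent_map G" and "C1_map G" and "G 0 = 0"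
  shows "\<forall>(D :: (real^2) set) (p :: int) (q :: int).
           topological_disc D \<longrightarrow> p \<noteq> q \<longrightarrow> G ` D \<inter> D = {} \<longrightarrow>
           int_iterate G p ` D \<inter> int_iterate G q ` D = {}"
proof (intro allI impI)
  fix D :: "(real^2) set" and p q :: int
  assume D: "topological_disc D" and pq: "p \<noteq> q" and disj: "G ` D \<inter> D = {}"
  obtain v \<psi> where v: "v \<noteq> 0" and \<psi>: "continuous_on UNIV \<psi>"
    and G: "\<And>z. G z = z + \<psi> (wedge v z) *\<^sub>R v"
    using unipotent_map_is_shear[OF assms] by metis
  note iter = int_iterate_translation_along_fibres[OF G]
  have w: "wedge v (z + t *\<^sub>R v) = wedge v z" for z t by (simp add: wedge_def algebra_simps)
  \<comment> \<open>Linear coordinates in which \<open>v\<close> becomes the second basis vector and \<open>G\<close> becomes a shear.\<close>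
  define C where "C z = (vector [wedge v z, (v \<bullet> z) / (v \<bullet> v)] :: real^2)" for z
  have C1: "C z $ 1 = wedge v z" and C2: "C z $ 2 = (v \<bullet> z) / (v \<bullet> v)" for z
    by (simp_all add: C_def)
  have conj: "C (z + (c * \<psi> (wedge v z)) *\<^sub>R v) = shear \<psi> c (C z)" for c z
    using v by (simp add: vec_eq_iff forall_2 C1 C2 w inner_add_right add_divide_distrib)
  have "inj C"
  proof (rule injI)
    fix x y assume e: "C x = C y"
    then have "wedge v x = wedge v y" "v \<bullet> x = v \<bullet> y" using v C1 C2
      by (metis, metis divide_cancel_right inner_eq_zero_iff)
    then have "wedge v (x - y) = 0" "v \<bullet> (x - y) = 0"
      by (simp_all add: linear_diff[OF bounded_linear.linear[OF bounded_linear_wedge]] inner_diff_right)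
    moreover from this obtain t where "x - y = t *\<^sub>R v" using wedge_eq_0 v by blast
    ultimately show "x = y" using v by simp
  qed
  have "continuous_on D C"
  proof -
    have "continuous_on D (\<lambda>z. wedge v z *\<^sub>R axis 1 1 + ((v \<bullet> z) / (v \<bullet> v)) *\<^sub>R axis 2 1 :: real^2)"
      using v by (intro continuous_intros linear_continuous_on[OF bounded_linear_wedge]) auto
    moreover have "C = (\<lambda>z. wedge v z *\<^sub>R axis 1 1 + ((v \<bullet> z) / (v \<bullet> v)) *\<^sub>R axis 2 1)"
      by (simp add: fun_eq_iff vec_eq_iff forall_2 C1 C2 axis_def)
    ultimately show ?thesis by simp
  qed
  define K where "K = C ` D"
  obtain f :: "real^2 \<Rightarrow> real^2" where f: "continuous_on (cball 0 1) f" "D = f ` cball 0 1"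
    using D unfolding topological_disc_def
    by (metis homeomorphic_def homeomorphic_sym homeomorphism_def)
  have "path_connected (cball 0 1 :: (real^2) set)" by (intro convex_imp_path_connected convex_cball)
  then have "compact D" "path_connected D" "D \<noteq> {}"
    unfolding f(2) using f(1)
    by (simp_all add: compact_continuous_image path_connected_continuous_image)
  then have K: "compact K" "path_connected K" "K \<noteq> {}"
    unfolding K_def using \<open>continuous_on D C\<close>
    by (auto intro: compact_continuous_image path_connected_continuous_image)
  have img: "shear \<psi> c ` K \<inter> K = C ` ((\<lambda>z. z + (c * \<psi> (wedge v z)) *\<^sub>R v) ` D \<inter> D)" for c
    by (simp add: K_def image_Int[OF \<open>inj C\<close>] image_image conj)
  have "(\<lambda>z. z + (1 * \<psi> (wedge v z)) *\<^sub>R v) ` D = G ` D" by (simp add: G)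
  then have "shear \<psi> 1 ` K \<inter> K = {}" unfolding img using disj by simp
  then have "shear \<psi> (real (Suc n)) ` K \<inter> K = {}" for n
    by (rule shear_disjoint_iterate[OF K \<psi>])
  then have free: "z + (real (Suc n) * \<psi> (wedge v z)) *\<^sub>R v \<notin> D" if "z \<in> D" for z n
    using that unfolding img by blast
  have no: False if "i < j" "x \<in> D" "y \<in> D" "int_iterate G i x = int_iterate G j y" for i j x y
  proof -
    have e: "x + (of_int i * \<psi> (wedge v x)) *\<^sub>R v = y + (of_int j * \<psi> (wedge v y)) *\<^sub>R v"
      using that(4) by (simp add: iter)
    then have xy: "wedge v x = wedge v y" by (metis w)
    \<comment> \<open>\<open>x\<close> is the image of \<open>y\<close> under the iterate of order \<open>j - i = Suc n\<close>.\<close>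
    define n where "n = nat (j - i - 1)"
    have n: "real (Suc n) = of_int j - of_int i" using that(1) by (simp add: n_def)
    have "x = y + (real (Suc n) * \<psi> (wedge v y)) *\<^sub>R v"
      unfolding n using e xy by (simp add: algebra_simps)
    then show False using free[OF that(3), of n] that(2) by simp
  qed
  show "int_iterate G p ` D \<inter> int_iterate G q ` D = {}"
  proof (rule ccontr)
    assume "int_iterate G p ` D \<inter> int_iterate G q ` D \<noteq> {}"
    then obtain x y where "x \<in> D" "y \<in> D" "int_iterate G p x = int_iterate G q y" by auto
    then show False using no[of p q x y] no[of q p y x] pq by (cases "p < q") auto
  qed
qed

end
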